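(* Let $F^{\dagger}\colon\Delta^7\to\mathbb{R}$ be the function defined by $F^{\dagger}(\mathbf{x})=\max\{f_i(\mathbf{x}) : i\in\{1,2,\dots,8\}\}$. Then $\inf_{\mathbf{x}\in\Delta^7}F^{\dagger}(\mathbf{x})=5+3\sqrt{2}$.
   Context: $\Delta^7=\{\mathbf{x}=(x_1,\dots,x_8)\in\mathbb{R}^8 : \sum_{i=1}^8x_i=1,\ x_i>0 \text{ for } 1\le i\le 8\}$. The functions $f_1,\dots,f_8\colon\Delta^7\to\mathbb{R}$ are $$f_1(\mathbf{x})=\frac{1-x_4-x_5-x_6}{x_4+x_5+x_6}\cdot\frac{1-x_1}{x_1},\qquad f_2(\mathbf{x})=\frac{1-x_4-x_5-x_6-x_7-x_8}{x_4+x_5+x_6+x_7+x_8}\cdot\frac{1-x_2}{x_2},$$ $$f_3(\mathbf{x})=\frac{1-x_1-x_2-x_3-x_7-x_8}{x_1+x_2+x_3+x_7+x_8}\cdot\frac{1-x_3}{x_3},\qquad f_4(\mathbf{x})=\frac{1-x_1-x_2-x_3}{x_1+x_2+x_3}\cdot\frac{1-x_4}{x_4},$$ $$f_5(\mathbf{x})=\frac{1-x_1-x_2-x_3-x_7-x_8}{x_1+x_2+x_3+x_7+x_8}\cdot\frac{1-x_5}{x_5},\qquad f_6(\mathbf{x})=\frac{1-x_4-x_5-x_6-x_7-x_8}{x_4+x_5+x_6+x_7+x_8}\cdot\frac{1-x_6}{x_6},$$ $$f_7(\mathbf{x})=\frac{1-x_4-x_5-x_6}{x_4+x_5+x_6}\cdot\frac{1-x_7}{x_7},\qquad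 f_8(\mathbf{x})=\frac{1-x_1-x_2-x_3}{x_1+x_2+x_3}\cdot\frac{1-x_8}{x_8}.$$ *)

theory Defs
  imports "HOL-Analysis.Analysis"
begin

text \<open>
  The index type \<open>8\<close> consists of the residues modulo 8, so the numerals \<open>1, \<dots>, 8\<close>
  denote its eight distinct elements (with \<open>8 = 0\<close>), and \<open>x $ 8\<close> is the eighth coordinate.
\<close>

definition Delta7 :: "(real ^ 8) set" where
  "Delta7 = {x. (\<Sum>i\<in>UNIV. x $ i) = 1 \<and> (\<forall>i. x $ i > 0)}"

definition f1 :: "real ^ 8 \<Rightarrow> real" where
  "f1 x = (1 - x$4 - x$5 - x$6) / (x$4 + x$5 + x$6) * ((1 - x$1) / x$1)"

definition f2 :: "real ^ 8 \<Rightarrow> real" where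
  "f2 x = (1 - x$4 - x$5 - x$6 - x$7 - x$8) / (x$4 + x$5 + x$6 + x$7 + x$8) * ((1 - x$2) / x$2)"

definition f3 :: "real ^ 8 \<Rightarrow> real" where
  "f3 x = (1 - x$1 - x$2 - x$3 - x$7 - x$8) / (x$1 + x$2 + x$3 + x$7 + x$8) * ((1 - x$3) / x$3)"

definition f4 :: "real ^ 8 \<Rightarrow> real" where
  "f4 x = (1 - x$1 - x$2 - x$3) / (x$1 + x$2 + x$3) * ((1 - x$4) / x$4)"

definition f5 :: "real ^ 8 \<Rightarrow> real" where
  "f5 x = (1 - x$1 - x$2 - x$3 - x$7 - x$8) / (x$1 + x$2 + x$3 + x$7 + x$8) * ((1 - x$5) / x$5)"

definition f6 :: "real ^ 8 \<Rightarrow> real" where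
  "f6 x = (1 - x$4 - x$5 - x$6 - x$7 - x$8) / (x$4 + x$5 + x$6 + x$7 + x$8) * ((1 - x$6) / x$6)"

definition f7 :: "real ^ 8 \<Rightarrow> real" where
  "f7 x = (1 - x$4 - x$5 - x$6) / (x$4 + x$5 + x$6) * ((1 - x$7) / x$7)"

definition f8 :: "real ^ 8 \<Rightarrow> real" where
  "f8 x = (1 - x$1 - x$2 - x$3) / (x$1 + x$2 + x$3) * ((1 - x$8) / x$8)"

definition F_dagger :: "real ^ 8 \<Rightarrow> real" where
  "F_dagger x = Max {f1 x, f2 x, f3 x, f4 x, f5 x, f6 x, f7 x, f8 x}"

text \<open>
  The real-valued \<open>Inf\<close> is the greatest lower bound only for nonempty sets that are
  bounded below; the next facts show that this is the case for \<open>F_dagger ` Delta7\<close>.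
\<close>

lemma UNIV_8: "(UNIV :: 8 set) = {1, 2, 3, 4, 5, 6, 7, 8}"
proof -
  have "card {1, 2, 3, 4, 5, 6, 7, 8 :: 8} = CARD(8)"
    by simp
  from card_subset_eq[OF finite_class.finite_UNIV subset_UNIV this] show ?thesis
    by (rule sym)
qed

lemma sum_8:
  "sum f (UNIV :: 8 set) = f 1 + f 2 + f 3 + f 4 + f 5 + f 6 + f 7 + (f 8 :: real)"
  unfolding UNIV_8 by (simp add: add.assoc)

lemma Delta7_nonempty: "Delta7 \<noteq> {}"
proof -
  have "((\<chi> i. 1 / 8) :: real ^ 8) \<in> Delta7"
    by (simp add: Delta7_def)
  then show ?thesis by blast
qed

lemma bdd_below_F_dagger: "bdd_below (F_dagger ` Delta7)"
proof (rule bdd_belowI2[where m = 0])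
  fix x assume x: "x \<in> Delta7"
  have s: "x$1 + x$2 + x$3 + x$4 + x$5 + x$6 + x$7 + x$8 = 1"
    using x unfolding Delta7_def sum_8 by blast
  have pos: "x $ i > 0" for i using x unfolding Delta7_def by blast
  note p = pos[of 1] pos[of 2] pos[of 3] pos[of 4] pos[of 5] pos[of 6] pos[of 7] pos[of 8]
  have "0 \<le> f1 x"
    unfolding f1_def using s p by (intro mult_nonneg_nonneg divide_nonneg_nonneg; linarith)
  also have "f1 x \<le> F_dagger x"
    unfolding F_dagger_def by (intro Max_ge) simp_all
  finally show "0 \<le> F_dagger x" .
qed

end

theory Submission
  imports Defs
begin

text \<open>
  Write \<open>A = x\<^sub>1 + x\<^sub>2 + x\<^sub>3\<close> and \<open>B = x\<^sub>4 + x\<^sub>5 + x\<^sub>6\<close>. For fixed \<open>A\<close> and \<open>B\<close>, each condition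
  \<open>f\<^sub>i < M = 5 + 3\<surd>2\<close> bounds \<open>x\<^sub>i\<close> below by a convex function of \<open>A\<close> or of \<open>B\<close>, hence by its
  tangent at \<open>a\<^sub>0 = 1 - \<surd>2/2\<close>, the value of \<open>A\<close> and \<open>B\<close> at the minimiser. With
  \<open>r = (3 - \<surd>2)/2\<close> the tangent slopes are \<open>-r\<close> for \<open>i = 1, 4, 7, 8\<close> and \<open>r/4\<close> for
  \<open>i = 2, 3, 5, 6\<close>. Put \<open>d = A + B - 2a\<^sub>0\<close>. Adding the bounds for \<open>x\<^sub>7, x\<^sub>8\<close> gives \<open>-d > -rd\<close>,
  so \<open>d < 0\<close> because \<open>r < 1\<close>, while adding the other six gives \<open>d > -rd/2\<close>, so \<open>d > 0\<close>.
\<close>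

text \<open>Clearing denominators gives \<open>x > (1 - b) / (1 + (4 + 3 * s) * b)\<close>. The
  claimed bound is the tangent of this convex function at \<open>1 - s / 2\<close>, so the gap times
  the denominator is a nonnegative multiple of a square.\<close>

lemma lower_bound_inverse_odds:
  fixes b x s :: real
  assumes s: "s * s = 2" "s \<ge> 0" and b: "0 < b" and x: "0 < x"
    and less: "(1 - b) / b * ((1 - x) / x) < 5 + 3 * s"
  shows "(s - 1) / 2 - (3 - s) / 2 * (b - (1 - s / 2)) < x"
proof -
  have "(1 - b) * (1 - x) < (5 + 3 * s) * (b * x)"
    using less b x by (simp add: pos_divide_less_eq)
  then have gt: "1 - b < x * (1 + (4 + 3 * s) * b)"
    by (simp add: algebra_simps)
  \<comment> \<open>The multiple of \<open>s * s - 2 = 0\<close> turns this into a polynomial identity.\<close>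
  have "1 - b - ((s - 1) / 2 - (3 - s) / 2 * (b - (1 - s / 2))) * (1 + (4 + 3 * s) * b)
      = (6 + 5 * s) / 2 * (b - (1 - s / 2))\<^sup>2 + (s * s - 2) *
        ((3 * s - 5) / 4 + (3 * s - 17) / 4 * (b - (1 - s / 2)) - 3 / 2 * (b - (1 - s / 2))\<^sup>2)"
    by (simp add: field_simps power2_eq_square)
  also have "\<dots> \<ge> 0"
    using s by simp
  finally have "((s - 1) / 2 - (3 - s) / 2 * (b - (1 - s / 2))) * (1 + (4 + 3 * s) * b)
      < x * (1 + (4 + 3 * s) * b)"
    using gt by linarith
  then show ?thesis
    by (rule mult_right_less_imp_less) (use s(2) b in simp)
qed

text \<open>The same tangent argument for \<open>b / (b + (5 + 3 * s) * (1 - b))\<close>, whose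
  denominator is positive as \<open>b < 1\<close>.\<close>

lemma lower_bound_odds:
  fixes b x s :: real
  assumes s: "s * s = 2" "s \<ge> 0" and b: "0 < b" "b < 1" and x: "0 < x"
    and less: "b / (1 - b) * ((1 - x) / x) < 5 + 3 * s"
  shows "(3 - 2 * s) / 4 + (3 - s) / 8 * (b - (1 - s / 2)) < x"
proof -
  have "b * (1 - x) < (5 + 3 * s) * ((1 - b) * x)"
    using less b x by (simp add: pos_divide_less_eq)
  then have gt: "b < x * (b + (5 + 3 * s) * (1 - b))"
    by (simp add: algebra_simps)
  have "b - ((3 - 2 * s) / 4 + (3 - s) / 8 * (b - (1 - s / 2))) * (b + (5 + 3 * s) * (1 - b))
      = (6 + 5 * s) / 8 * (b - (1 - s / 2))\<^sup>2 + (s * s - 2) *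
        ((6 * s - 1) / 8 + (3 * s - 29) / 16 * (b - (1 - s / 2)) - 3 / 8 * (b - (1 - s / 2))\<^sup>2)"
    by (simp add: field_simps power2_eq_square)
  also have "\<dots> \<ge> 0"
    using s by simp
  finally have "((3 - 2 * s) / 4 + (3 - s) / 8 * (b - (1 - s / 2))) * (b + (5 + 3 * s) * (1 - b))
      < x * (b + (5 + 3 * s) * (1 - b))"
    using gt by linarith
  then show ?thesis
    by (rule mult_right_less_imp_less) (use s(2) b in simp)
qed

lemma tangent_bounds_inconsistent:
  fixes x1 x2 x3 x4 x5 x6 x7 x8 s :: real
  assumes s: "1 < s" "s < 2"
    and sum1: "x1 + x2 + x3 + x4 + x5 + x6 + x7 + x8 = 1"
    and l:
    "(s - 1) / 2 - (3 - s) / 2 * (x4 + x5 + x6 - (1 - s / 2)) < x1"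
    "(3 - 2 * s) / 4 + (3 - s) / 8 * (x1 + x2 + x3 - (1 - s / 2)) < x2"
    "(3 - 2 * s) / 4 + (3 - s) / 8 * (x4 + x5 + x6 - (1 - s / 2)) < x3"
    "(s - 1) / 2 - (3 - s) / 2 * (x1 + x2 + x3 - (1 - s / 2)) < x4"
    "(3 - 2 * s) / 4 + (3 - s) / 8 * (x4 + x5 + x6 - (1 - s / 2)) < x5"
    "(3 - 2 * s) / 4 + (3 - s) / 8 * (x1 + x2 + x3 - (1 - s / 2)) < x6"
    "(s - 1) / 2 - (3 - s) / 2 * (x4 + x5 + x6 - (1 - s / 2)) < x7"
    "(s - 1) / 2 - (3 - s) / 2 * (x1 + x2 + x3 - (1 - s / 2)) < x8"
  shows False
proof -
  define D E where "D = x1 + x2 + x3 - (1 - s / 2)"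
    and "E = x4 + x5 + x6 - (1 - s / 2)"
  \<comment> \<open>Naming these products makes all eight bounds linear; their constants cancel when
    added.\<close>
  define u v where "u = (3 - s) / 2 * D" and "v = (3 - s) / 2 * E"
  have slopes: "(3 - s) / 8 * D = u / 4" "(3 - s) / 8 * E = v / 4"
    by (simp_all add: u_def v_def)
  note l' = l[folded D_def E_def, unfolded slopes, folded u_def v_def,
      unfolded diff_divide_distrib]
  have D_plus_E: "D + E = x1 + x2 + x3 + (x4 + x5 + x6) - 2 + s"
    by (simp add: D_def E_def)
  have "D + E < u + v"
    using l'(7,8) D_plus_E sum1 by linarith
  \<comment> \<open>\<open>s - 1 = 2 * (1 - r)\<close> with \<open>r = (3 - s) / 2\<close>.\<close>
  then have "(s - 1) * (D + E) < 0"
    by (simp add: u_def v_def field_simps)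
  then have neg: "D + E < 0"
    using s(1) by (simp add: mult_less_0_iff)
  have "- u / 2 - v / 2 < D + E"
    using l'(1-6) D_plus_E by linarith
  \<comment> \<open>\<open>7 - s = 4 * (1 + r / 2)\<close>.\<close>
  then have "0 < (7 - s) * (D + E)"
    by (simp add: u_def v_def field_simps)
  then have "0 < D + E"
    using s(2) by (simp add: zero_less_mult_iff)
  with neg show False
    by simp
qed

lemma F_dagger_ge:
  assumes x: "x \<in> Delta7"
  shows "5 + 3 * sqrt 2 \<le> F_dagger x"
proof (rule ccontr)
  assume "\<not> 5 + 3 * sqrt 2 \<le> F_dagger x"
  then have "F_dagger x < 5 + 3 * sqrt 2"
    by simp
  then have f: "f1 x < 5 + 3 * sqrt 2" "f2 x < 5 + 3 * sqrt 2" "f3 x < 5 + 3 * sqrt 2"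
    "f4 x < 5 + 3 * sqrt 2" "f5 x < 5 + 3 * sqrt 2" "f6 x < 5 + 3 * sqrt 2"
    "f7 x < 5 + 3 * sqrt 2" "f8 x < 5 + 3 * sqrt 2"
    by (simp_all only: F_dagger_def Max_less_iff finite_insert finite.emptyI insert_not_empty
        ball_simps simp_thms)
  define s where "s = sqrt 2"
  have s: "s * s = 2" "s \<ge> 0"
    by (simp_all add: s_def)
  have s_gt: "1 < s" and s_lt: "s < 2"
    by (simp_all add: s_def real_less_lsqrt)
  have sum1: "x$1 + x$2 + x$3 + x$4 + x$5 + x$6 + x$7 + x$8 = 1"
    using x unfolding Delta7_def sum_8 by blast
  have pos: "x $ i > 0" for i
    using x unfolding Delta7_def by blast
  note p = pos[of 1] pos[of 2] pos[of 3] pos[of 4] pos[of 5] pos[of 6] pos[of 7] pos[of 8]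
  define A B where "A = x$1 + x$2 + x$3" and "B = x$4 + x$5 + x$6"
  have A: "0 < A" "A < 1" and B: "0 < B" "B < 1"
    using p sum1 unfolding A_def B_def by linarith+
  \<comment> \<open>The last four left-hand sides already have \<open>A\<close> and \<open>B\<close> rewritten by the first four.\<close>
  have eqs: "x$4 + x$5 + x$6 = B" "x$1 + x$2 + x$3 = A" "1 - x$4 - x$5 - x$6 = 1 - B"
    "1 - x$1 - x$2 - x$3 = 1 - A"
    "B + x$7 + x$8 = 1 - A" "A + x$7 + x$8 = 1 - B"
    "1 - B - x$7 - x$8 = A" "1 - A - x$7 - x$8 = B"
    using sum1 unfolding A_def B_def by linarith+
  note g = f[unfolded f1_def f2_def f3_def f4_def f5_def f6_def f7_def f8_def eqs,
      folded s_def]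
  note l = lower_bound_inverse_odds[OF s B(1) pos g(1)] lower_bound_odds[OF s A pos g(2)]
    lower_bound_odds[OF s B pos g(3)] lower_bound_inverse_odds[OF s A(1) pos g(4)]
    lower_bound_odds[OF s B pos g(5)] lower_bound_odds[OF s A pos g(6)]
    lower_bound_inverse_odds[OF s B(1) pos g(7)] lower_bound_inverse_odds[OF s A(1) pos g(8)]
  show False
    by (rule tangent_bounds_inconsistent[OF s_gt s_lt sum1 l[unfolded A_def B_def]])
qed

text \<open>The coordinates are the tangent values at the contact point
  \<open>A = B = 1 - sqrt 2 / 2\<close>, where all eight functions agree.\<close>

definition minimiser :: "real ^ 8" where
  "minimiser = (\<chi> i. if i \<in> {1, 4, 7, 8} then (sqrt 2 - 1) / 2 else (3 - 2 * sqrt 2) / 4)"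

lemma minimiser_nth:
  "minimiser $ 1 = (sqrt 2 - 1) / 2" "minimiser $ 2 = (3 - 2 * sqrt 2) / 4"
  "minimiser $ 3 = (3 - 2 * sqrt 2) / 4" "minimiser $ 4 = (sqrt 2 - 1) / 2"
  "minimiser $ 5 = (3 - 2 * sqrt 2) / 4" "minimiser $ 6 = (3 - 2 * sqrt 2) / 4"
  "minimiser $ 7 = (sqrt 2 - 1) / 2" "minimiser $ 8 = (sqrt 2 - 1) / 2"
  by (simp_all add: minimiser_def)

lemma sqrt_2_bounds: "1 < sqrt 2" "2 * sqrt 2 < (3::real)"
proof -
  show "1 < sqrt (2::real)"
    by simp
  have "sqrt 2 < (3 / 2 :: real)"
    by (rule real_less_lsqrt) (simp_all add: power2_eq_square)
  then show "2 * sqrt 2 < (3::real)"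
    by simp
qed

lemma minimiser_in_Delta7: "minimiser \<in> Delta7"
proof -
  have "(\<Sum>i\<in>UNIV. minimiser $ i) = 1"
    unfolding sum_8 minimiser_nth by (simp add: field_simps)
  moreover have "minimiser $ i > 0" for i
    using sqrt_2_bounds by (simp add: minimiser_def)
  ultimately show ?thesis
    by (simp add: Delta7_def)
qed

lemma F_dagger_minimiser: "F_dagger minimiser = 5 + 3 * sqrt 2"
proof -
  define s :: real where "s = sqrt 2"
  have s: "s * s = 2" "1 < s" "2 * s < 3"
    using sqrt_2_bounds by (simp_all add: s_def)
  have ne: "s - 1 \<noteq> 0" "3 - 2 * s \<noteq> 0" "2 - s \<noteq> 0" "s \<noteq> 0"
    using s(2,3) by linarith+
  have p_odds: "(1 - (s - 1) / 2) / ((s - 1) / 2) = (3 - s) / (s - 1)"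
    using ne by (simp add: divide_simps) (simp add: algebra_simps)
  \<comment> \<open>The cross-multiplied form of \<open>p\<close>, up to a multiple of
    \<open>s * s - 2 = 0\<close>.\<close>
  have "s * (3 - s) = (5 + 3 * s) * ((2 - s) * (s - 1)) + (s * s - 2) * (3 * s - 5)"
    by (simp add: algebra_simps)
  then have p: "s / (2 - s) * ((1 - (s - 1) / 2) / ((s - 1) / 2)) = 5 + 3 * s"
    unfolding p_odds using ne s(1) by (simp add: nonzero_divide_eq_eq)
  have q_odds: "(1 - (3 - 2 * s) / 4) / ((3 - 2 * s) / 4) = (1 + 2 * s) / (3 - 2 * s)"
    using ne by (simp add: divide_simps) (simp add: algebra_simps)
  have "(2 - s) * (1 + 2 * s) = (5 + 3 * s) * (s * (3 - 2 * s)) + (s * s - 2) * (6 * s - 1)"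
    by (simp add: algebra_simps)
  then have q: "(2 - s) / s * ((1 - (3 - 2 * s) / 4) / ((3 - 2 * s) / 4)) = 5 + 3 * s"
    unfolding q_odds using ne s(1) by (simp add: nonzero_divide_eq_eq)
  let ?p = "(s - 1) / 2" and ?q = "(3 - 2 * s) / 4"
  \<comment> \<open>Blocks of three sum to \<open>1 - s / 2\<close>, blocks of five to
    \<open>s / 2\<close>.\<close>
  have odds: "(1 - ?p - ?q - ?q) / (?p + ?q + ?q) = s / (2 - s)"
    "(1 - ?q - ?q - ?p) / (?q + ?q + ?p) = s / (2 - s)"
    "(1 - ?p - ?q - ?q - ?p - ?p) / (?p + ?q + ?q + ?p + ?p) = (2 - s) / s"
    using ne by (simp_all add: divide_simps)
  have "f1 minimiser = 5 + 3 * s" "f2 minimiser = 5 + 3 * s" "f3 minimiser = 5 + 3 * s"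
    "f4 minimiser = 5 + 3 * s" "f5 minimiser = 5 + 3 * s" "f6 minimiser = 5 + 3 * s"
    "f7 minimiser = 5 + 3 * s" "f8 minimiser = 5 + 3 * s"
    unfolding f1_def f2_def f3_def f4_def f5_def f6_def f7_def f8_def minimiser_nth
      s_def[symmetric] odds
    by (rule p q)+
  then show ?thesis
    by (simp add: F_dagger_def s_def)
qed

theorem theorem4p14:
  shows "(INF x \<in> Delta7. F_dagger x) = 5 + 3 * sqrt 2"
proof (rule cInf_eq_minimum)
  show "5 + 3 * sqrt 2 \<in> F_dagger ` Delta7"
    using minimiser_in_Delta7 by (simp add: F_dagger_minimiser[symmetric])
qed (auto intro: F_dagger_ge)

end
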